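(* Let $G=(V,E)$ be a connected finite graph with positive symmetric edge weights $w_{xy}=w_{yx}$ $(xy\in E)$ and a measure $\mu:V\to\mathbb{R}^{+}$. Let $x_0\in V$ be a fixed vertex, write $\delta_0$ for the Dirac delta at $x_0$, and let $\rho>0$ be a constant. Then the equation $$\Delta u+e^{u}=\rho\,\delta_0 \quad\text{on } V$$ has a solution $u:V\to\mathbb{R}$.
   Context: For $u:V\to\mathbb{R}$, the Laplace operator is $\Delta u(x)=\frac{1}{\mu(x)}\sum_{y\sim x}w_{xy}(u(y)-u(x))$, where $y\sim x$ means $xy\in E$. The measure satisfies $\mu(x)>0$ for every $x\in V$, and $\int_V f\,d\mu=\sum_{x\in V}f(x)\mu(x)$. The Dirac delta at the vertex $x_0$ (denoted "0" in the equation) is normalized by $\int_V\delta_0\,d\mu=1$, i.e. $\delta_0(x_0)=1/\mu(x_0)$ and $\delta_0(x)=0$ for $x\neq x_0$. A solution is a function $u:V\to\mathbb{R}$ satisfying the equation at every vertex. *)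

theory Defs
  imports "HOL-Analysis.Analysis" "Graph_Theory.Digraph_Component"
begin

text \<open>
  An undirected simple graph is a \<^typ>\<open>'a pair_pre_digraph\<close> satisfying
  \<^const>\<open>pair_graph\<close> (finite, loop-free, symmetric): the edge \<open>xy\<close> is the pair of
  arcs \<open>(x, y)\<close> and \<open>(y, x)\<close>, so \<open>y \<sim> x\<close> is \<open>(x, y) \<in> parcs G\<close>.
  Vertex functions are total on \<open>'a\<close>; only their values on \<open>pverts G\<close> matter,
  and only the values of \<open>w\<close> on arcs.
\<close>

definition graph_laplacian ::
  "'a pair_pre_digraph \<Rightarrow> ('a \<Rightarrow> 'a \<Rightarrow> real) \<Rightarrow> ('a \<Rightarrow> real) \<Rightarrow> ('a \<Rightarrow> real) \<Rightarrow> 'a \<Rightarrow> real" where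
  "graph_laplacian G w \<mu> u x = (1 / \<mu> x) * (\<Sum>y | (x, y) \<in> parcs G. w x y * (u y - u x))"

definition dirac_delta :: "('a \<Rightarrow> real) \<Rightarrow> 'a \<Rightarrow> 'a \<Rightarrow> real" where
  "dirac_delta \<mu> x0 x = (if x = x0 then 1 / \<mu> x0 else 0)"

lemma integral_dirac_delta:
  assumes "finite V" and "x0 \<in> V" and "\<mu> x0 > 0"
  shows "(\<Sum>x\<in>V. dirac_delta \<mu> x0 x * \<mu> x) = 1"
proof -
  have "(\<Sum>x\<in>V. dirac_delta \<mu> x0 x * \<mu> x) = (\<Sum>x\<in>V. if x = x0 then 1 else 0)"
    using assms(3) by (intro sum.cong) (auto simp: dirac_delta_def)
  then show ?thesis using assms(1,2) by simp
qed

end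

theory Submission
  imports Defs
begin

text \<open>
  The equation is variational. Write \<open>D(u, v) = 1/2 * (\<Sum> w\<^sub>a\<^sub>b (u b - u a) (v b - v a))\<close>, summed
  over arcs, for the Dirichlet form and \<open>M(u) = \<integral> e\<^sup>u d\<mu>\<close> for the mass, and consider
  \<open>J(u) = D(u, u) / 2 + \<rho> * u(x\<^sub>0) - \<rho> * ln M(u)\<close>.
  By Green's formula (\<open>green_formula\<close>) a critical point \<open>u\<close> of \<open>J\<close> satisfies
  \<open>\<Delta>u + (\<rho> / M(u)) * e\<^sup>u = \<rho> * \<delta>\<^sub>0\<close> (\<open>euler_lagrange\<close>), and the factor \<open>\<rho> / M(u)\<close> is absorbed by adding the constant
  \<open>ln (\<rho> / M(u))\<close> to \<open>u\<close>, which leaves \<open>\<Delta>u\<close> unchanged. Using the logarithm of the mass, rather than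
  constraining the mass to be \<open>\<rho>\<close>, makes the minimization unconstrained.

  A minimizer exists because \<open>J\<close> is invariant under adding constants, so that one may normalize
  \<open>u(x\<^sub>0) = 0\<close>, and because connectedness yields a Poincare inequality (\<open>poincare_inequality\<close>)
  \<open>\<bar>u x - u x\<^sub>0\<bar> \<le> C * sqrt (D(u, u))\<close>. Under the normalization \<open>ln M(u)\<close> therefore exceeds \<open>ln M(0)\<close> by
  at most \<open>C * sqrt (D(u, u))\<close>, which the quadratic term dominates: \<open>J(u) \<le> J(0)\<close> forces
  \<open>\<bar>u\<bar> \<le> 2 * \<rho> * C\<^sup>2\<close> (\<open>sublevel_bound\<close>), and the minimum of \<open>J\<close> over this compact box is a global one.
\<close>

section \<open>The Dirichlet form and Green's formula\<close>

locale weighted_graph = pair_graph G for G :: "'a pair_pre_digraph" +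
  fixes w :: "'a \<Rightarrow> 'a \<Rightarrow> real"
    and \<mu> :: "'a \<Rightarrow> real"
  assumes weight_pos: "(x, y) \<in> parcs G \<Longrightarrow> w x y > 0"
    and weight_sym: "(x, y) \<in> parcs G \<Longrightarrow> w x y = w y x"
    and measure_pos: "x \<in> pverts G \<Longrightarrow> \<mu> x > 0"
begin

text \<open>The factor 1/2 compensates for every edge being counted once per orientation.\<close>

definition dirichlet_form :: "('a \<Rightarrow> real) \<Rightarrow> ('a \<Rightarrow> real) \<Rightarrow> real" where
  "dirichlet_form u v = (\<Sum>(a, b)\<in>parcs G. w a b * (u b - u a) * (v b - v a)) / 2"

lemma dirichlet_form_cong:
  assumes "\<And>a b. (a, b) \<in> parcs G \<Longrightarrow> u b - u a = u' b - u' a"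
    and "\<And>a b. (a, b) \<in> parcs G \<Longrightarrow> v b - v a = v' b - v' a"
  shows "dirichlet_form u v = dirichlet_form u' v'"
  unfolding dirichlet_form_def using assms
  by (intro arg_cong[where f = "\<lambda>s. s / 2"] sum.cong) auto

lemma dirichlet_form_line:
  "dirichlet_form (\<lambda>x. u x + t * v x) (\<lambda>x. u x + t * v x) =
     dirichlet_form u u + 2 * t * dirichlet_form u v + t\<^sup>2 * dirichlet_form v v"
  unfolding dirichlet_form_def
  by (simp add: sum_distrib_left sum.distrib[symmetric] sum_divide_distrib)
    (intro sum.cong; auto simp: algebra_simps power2_eq_square add_divide_distrib diff_divide_distrib)

lemma dirichlet_form_nonneg: "0 \<le> dirichlet_form u u"
  unfolding dirichlet_form_def
  by (intro divide_nonneg_nonneg sum_nonneg)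
    (auto simp: mult.assoc intro: less_imp_le[OF weight_pos] mult_nonneg_nonneg[OF _ zero_le_square])

lemma sum_parcs: "(\<Sum>(a, b)\<in>parcs G. f a b) = (\<Sum>a\<in>pverts G. \<Sum>b | (a, b) \<in> parcs G. f a b)"
proof -
  have "parcs G = (SIGMA a:pverts G. {b. (a, b) \<in> parcs G})"
    using in_arcsD1 by auto
  moreover have "finite {b. (a, b) \<in> parcs G}" for a
    by (rule finite_subset[OF _ pair_finite_verts]) (auto dest: in_arcsD2)
  ultimately show ?thesis
    using sum.Sigma[of "pverts G" "\<lambda>a. {b. (a, b) \<in> parcs G}" f] pair_finite_verts by simp
qed

text \<open>
  Reversing all arcs exchanges \<open>v a\<close> with \<open>v b\<close>, flips the sign of \<open>u b - u a\<close> and keeps the weight,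
  so the two summands \<open>v b\<close> and \<open>- v a\<close> contribute equally to the form.
\<close>

lemma green_formula:
  "dirichlet_form u v = - (\<Sum>x\<in>pverts G. graph_laplacian G w \<mu> u x * v x * \<mu> x)"
proof -
  have rev: "(\<Sum>(a, b)\<in>parcs G. w a b * (u b - u a) * v b) =
             - (\<Sum>(a, b)\<in>parcs G. w a b * (u b - u a) * v a)"
  proof -
    have "(\<Sum>(a, b)\<in>parcs G. w a b * (u b - u a) * v b) =
          (\<Sum>(a, b)\<in>parcs G. w b a * (u a - u b) * v a)"
      by (rule sum.reindex_bij_witness[of _ prod.swap prod.swap])
        (use arcs_symmetric in auto)
    also have "\<dots> = (\<Sum>(a, b)\<in>parcs G. - (w a b * (u b - u a) * v a))"
      by (intro sum.cong) (auto dest: weight_sym simp: right_diff_distrib left_diff_distrib)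
    finally show ?thesis
      by (simp add: case_prod_unfold sum_negf)
  qed
  have "2 * dirichlet_form u v =
      (\<Sum>(a, b)\<in>parcs G. w a b * (u b - u a) * v b) - (\<Sum>(a, b)\<in>parcs G. w a b * (u b - u a) * v a)"
    by (simp add: dirichlet_form_def case_prod_unfold sum_subtractf[symmetric] right_diff_distrib)
  with rev have "dirichlet_form u v = - (\<Sum>(a, b)\<in>parcs G. w a b * (u b - u a) * v a)"
    by simp
  also have "\<dots> = - (\<Sum>x\<in>pverts G. graph_laplacian G w \<mu> u x * v x * \<mu> x)"
    unfolding sum_parcs
    by (intro arg_cong[where f = uminus] sum.cong)
      (auto simp: graph_laplacian_def sum_distrib_right[symmetric] dest: measure_pos)
  finally show ?thesis .
qed

section \<open>A Poincare inequality\<close>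

text \<open>A single term of the form bounds the increment of \<open>u\<close> along an arc.\<close>

lemma arc_increment_le:
  assumes "(x, y) \<in> parcs G"
  shows "\<bar>u y - u x\<bar> \<le> sqrt (2 / w x y) * sqrt (dirichlet_form u u)"
proof -
  have "w x y * (u y - u x)\<^sup>2 \<le> 2 * dirichlet_form u u"
    unfolding dirichlet_form_def
    using member_le_sum[OF assms, of "\<lambda>(a, b). w a b * (u b - u a) * (u b - u a)"] pair_finite_arcs
      weight_pos
    by (fastforce simp: power2_eq_square mult.assoc intro: less_imp_le)
  then have "(u y - u x)\<^sup>2 \<le> 2 / w x y * dirichlet_form u u"
    using weight_pos[OF assms] by (simp add: field_simps)
  then have "sqrt ((u y - u x)\<^sup>2) \<le> sqrt (2 / w x y * dirichlet_form u u)"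
    by (rule real_sqrt_le_mono)
  then show ?thesis
    by (simp only: real_sqrt_abs real_sqrt_mult)
qed

lemma increment_le_of_reachable:
  assumes "reachable (with_proj G) x0 x"
  shows "\<exists>C\<ge>0. \<forall>u. \<bar>u x - u x0\<bar> \<le> C * sqrt (dirichlet_form u u)"
  using assms
proof (induction rule: reachable_induct)
  case base
  show ?case by (intro exI[of _ 0]) simp
next
  case (step y z)
  from step.IH obtain C
    where C: "C \<ge> 0" "\<And>u. \<bar>u y - u x0\<bar> \<le> C * sqrt (dirichlet_form u u)" by blast
  have yz: "(y, z) \<in> parcs G" using step.hyps by simp
  have "\<bar>u z - u x0\<bar> \<le> (C + sqrt (2 / w y z)) * sqrt (dirichlet_form u u)" for u
    using C(2)[of u] arc_increment_le[OF yz, of u] by (simp add: distrib_right)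
  then show ?case
    using C(1) weight_pos[OF yz] by (intro exI[of _ "C + sqrt (2 / w y z)"]) simp
qed

lemma poincare_inequality:
  assumes "Digraph_Component.connected (with_proj G)" and "x0 \<in> pverts G"
  obtains C where "C \<ge> 0"
    and "\<And>u x. x \<in> pverts G \<Longrightarrow> \<bar>u x - u x0\<bar> \<le> C * sqrt (dirichlet_form u u)"
proof -
  have "strongly_connected (with_proj G)"
    using symmetric_connected_imp_strongly_connected sym_arcs assms(1) by blast
  then have "\<forall>x\<in>pverts G. \<exists>C\<ge>0. \<forall>u. \<bar>u x - u x0\<bar> \<le> C * sqrt (dirichlet_form u u)"
    using increment_le_of_reachable assms(2) by (auto simp: strongly_connected_def)
  then obtain c where c: "\<And>x. x \<in> pverts G \<Longrightarrow> c x \<ge> 0"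
    "\<And>x u. x \<in> pverts G \<Longrightarrow> \<bar>u x - u x0\<bar> \<le> c x * sqrt (dirichlet_form u u)"
    by metis
  show thesis
  proof (rule that)
    show "(\<Sum>x\<in>pverts G. c x) \<ge> 0" using c(1) by (rule sum_nonneg)
    fix u x assume x: "x \<in> pverts G"
    have "c x \<le> (\<Sum>x\<in>pverts G. c x)"
      using c(1) by (intro member_le_sum x pair_finite_verts) auto
    then have "c x * sqrt (dirichlet_form u u) \<le> (\<Sum>x\<in>pverts G. c x) * sqrt (dirichlet_form u u)"
      by (intro mult_right_mono) (simp_all add: dirichlet_form_nonneg)
    with c(2)[OF x, of u]
    show "\<bar>u x - u x0\<bar> \<le> (\<Sum>x\<in>pverts G. c x) * sqrt (dirichlet_form u u)" by linarith
  qed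
qed

section \<open>The functional and its minimizer\<close>

definition exp_mass :: "('a \<Rightarrow> real) \<Rightarrow> real" where
  "exp_mass u = (\<Sum>x\<in>pverts G. exp (u x) * \<mu> x)"

definition liouville_functional :: "'a \<Rightarrow> real \<Rightarrow> ('a \<Rightarrow> real) \<Rightarrow> real" where
  "liouville_functional x0 \<rho> u = dirichlet_form u u / 2 + \<rho> * u x0 - \<rho> * ln (exp_mass u)"

lemma exp_mass_pos:
  assumes "pverts G \<noteq> {}"
  shows "exp_mass u > 0"
  unfolding exp_mass_def using assms pair_finite_verts measure_pos by (intro sum_pos) auto

lemma exp_mass_add_const:
  assumes "\<And>x. x \<in> pverts G \<Longrightarrow> v x = u x + c"
  shows "exp_mass v = exp c * exp_mass u"
  unfolding exp_mass_def sum_distrib_left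
  by (intro sum.cong) (auto simp: assms exp_add)

lemma liouville_functional_add_const:
  assumes "x0 \<in> pverts G" and "\<And>x. x \<in> pverts G \<Longrightarrow> v x = u x + c"
  shows "liouville_functional x0 \<rho> v = liouville_functional x0 \<rho> u"
proof -
  have "dirichlet_form v v = dirichlet_form u u"
    by (intro dirichlet_form_cong) (simp_all add: assms(2) in_arcsD1 in_arcsD2)
  moreover have "ln (exp_mass v) = c + ln (exp_mass u)"
    using exp_mass_add_const[of v u c] assms exp_mass_pos[of u] by (fastforce simp: ln_mult_pos)
  ultimately show ?thesis
    unfolding liouville_functional_def using assms by (simp add: algebra_simps)
qed

lemma continuous_on_liouville_functional:
  assumes "pverts G \<noteq> {}"
  shows "continuous_on S (liouville_functional x0 \<rho>)"
proof -
  have "continuous_on S (\<lambda>u. u x)" for x :: 'a and S :: "('a \<Rightarrow> real) set"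
    by (rule continuous_on_subset[OF continuous_on_product_coordinates]) simp
  moreover have "exp_mass u \<noteq> 0" for u
    using exp_mass_pos[OF assms, of u] by simp
  ultimately show ?thesis
    unfolding liouville_functional_def dirichlet_form_def exp_mass_def case_prod_unfold
    by (intro continuous_intros) auto
qed

text \<open>
  With \<open>s = sqrt (dirichlet_form u u)\<close> the Poincare inequality gives
  \<open>J(u) - J(0) \<ge> s\<^sup>2 / 2 - \<rho> * C * s\<close>, so \<open>s \<le> 2 * \<rho> * C\<close> on the sublevel set of \<open>J(0)\<close>;
  a second use of the inequality turns this into a bound on \<open>u\<close>.
\<close>

lemma sublevel_bound:
  assumes "C \<ge> 0" and "\<rho> > 0" and "x0 \<in> pverts G" and "u x0 = 0"
    and poincare: "\<And>x. x \<in> pverts G \<Longrightarrow> \<bar>u x - u x0\<bar> \<le> C * sqrt (dirichlet_form u u)"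
    and sublevel: "liouville_functional x0 \<rho> u \<le> liouville_functional x0 \<rho> (\<lambda>x. 0)"
    and "x \<in> pverts G"
  shows "\<bar>u x\<bar> \<le> 2 * \<rho> * C\<^sup>2"
proof -
  define s where "s = sqrt (dirichlet_form u u)"
  have s: "s \<ge> 0" "dirichlet_form u u = s\<^sup>2"
    by (simp_all add: s_def dirichlet_form_nonneg)
  have le: "\<bar>u y\<bar> \<le> C * s" if "y \<in> pverts G" for y
    using poincare[OF that] by (simp add: s_def assms(4))
  have pos: "exp_mass v > 0" for v
    using exp_mass_pos assms(3) by blast
  have "exp_mass u \<le> exp_mass (\<lambda>x. 0 + C * s)"
    unfolding exp_mass_def
    by (intro sum_mono mult_right_mono) (auto dest: le measure_pos)
  also have "\<dots> = exp (C * s) * exp_mass (\<lambda>x. 0)"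
    by (rule exp_mass_add_const) simp
  finally have "ln (exp_mass u) \<le> ln (exp (C * s) * exp_mass (\<lambda>x. 0))"
    using pos by simp
  then have "ln (exp_mass u) \<le> C * s + ln (exp_mass (\<lambda>x. 0))"
    using pos by (simp add: ln_mult_pos)
  then have "\<rho> * ln (exp_mass u) \<le> \<rho> * (C * s + ln (exp_mass (\<lambda>x. 0)))"
    using assms(2) by simp
  moreover have "s\<^sup>2 / 2 - \<rho> * ln (exp_mass u) \<le> - \<rho> * ln (exp_mass (\<lambda>x. 0))"
  proof -
    have "dirichlet_form (\<lambda>x. 0) (\<lambda>x. 0) = 0" by (simp add: dirichlet_form_def)
    with sublevel show ?thesis by (simp add: liouville_functional_def s(2) assms(4))
  qed
  ultimately have "s\<^sup>2 / 2 \<le> \<rho> * C * s"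
    by (simp add: algebra_simps)
  then have "s * s \<le> (2 * \<rho> * C) * s"
    by (simp add: power2_eq_square)
  then have "s \<le> 2 * \<rho> * C"
    using s(1) assms(1,2) by (cases "s = 0") auto
  then have "C * s \<le> C * (2 * \<rho> * C)"
    using assms(1) by (rule mult_left_mono)
  with le[OF assms(7)] show ?thesis
    by (simp add: power2_eq_square algebra_simps)
qed

text \<open>
  The functional only sees the values on the vertices. Pinning the values elsewhere to 0 puts the
  candidates into a product of compact intervals, so that Tychonoff's theorem applies to functions
  on the whole type.
\<close>

lemma liouville_functional_attains_min:
  assumes "Digraph_Component.connected (with_proj G)" and "x0 \<in> pverts G" and "\<rho> > 0"
  obtains u where "\<And>v. liouville_functional x0 \<rho> u \<le> liouville_functional x0 \<rho> v"
proof -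
  let ?J = "liouville_functional x0 \<rho>"
  obtain C where C: "C \<ge> 0"
    "\<And>u x. x \<in> pverts G \<Longrightarrow> \<bar>u x - u x0\<bar> \<le> C * sqrt (dirichlet_form u u)"
    using poincare_inequality[OF assms(1,2)] by blast
  define R where "R = 2 * \<rho> * C\<^sup>2"
  have R: "R \<ge> 0" using assms(3) by (simp add: R_def)
  define I where "I x = (if x \<in> pverts G - {x0} then {- R..R} else {0})" for x
  define K where "K = (\<Pi>\<^sub>E x\<in>UNIV. I x)"
  have "compactin (product_topology (\<lambda>_. euclidean) UNIV) K"
    unfolding K_def compactin_PiE by (auto simp: I_def)
  then have "compact K"
    by (simp add: euclidean_product_topology)
  moreover have zero: "(\<lambda>x. 0) \<in> K"
    using R by (auto simp: K_def I_def)
  moreover have "continuous_on K ?J"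
    using continuous_on_liouville_functional assms(2) by blast
  ultimately obtain u where u: "u \<in> K" "\<And>v. v \<in> K \<Longrightarrow> ?J u \<le> ?J v"
    using continuous_attains_inf[of K ?J] by blast
  have "?J u \<le> ?J v" for v
  proof -
    define v' where "v' x = (if x \<in> pverts G then v x - v x0 else 0)" for x
    have same: "?J v' = ?J v"
      by (rule liouville_functional_add_const[OF assms(2), where c = "- v x0"]) (simp add: v'_def)
    show ?thesis
    proof (cases "?J v' \<le> ?J (\<lambda>x. 0)")
      case True
      have "v' x0 = 0" by (simp add: v'_def)
      then have bound: "\<bar>v' x\<bar> \<le> R" if "x \<in> pverts G" for x
        unfolding R_def using sublevel_bound[OF C(1) assms(3,2) _ C(2) True that] by simp
      have "v' x \<in> I x" for x
      proof (cases "x \<in> pverts G - {x0}")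
        case True
        then show ?thesis using bound[of x] by (simp add: I_def abs_le_iff)
      next
        case False
        then show ?thesis using \<open>v' x0 = 0\<close> by (auto simp: I_def v'_def)
      qed
      then have "v' \<in> K"
        by (auto simp: K_def)
      then show ?thesis using u(2)[of v'] same by simp
    next
      case False
      then show ?thesis using u(2)[OF zero] same by linarith
    qed
  qed
  then show thesis by (rule that)
qed

section \<open>The Euler-Lagrange equation\<close>

lemma has_real_derivative_liouville_functional:
  assumes "pverts G \<noteq> {}"
  shows "((\<lambda>t. liouville_functional x0 \<rho> (\<lambda>x. u x + t * \<phi> x)) has_real_derivative
           dirichlet_form u \<phi> + \<rho> * \<phi> x0
             - \<rho> * ((\<Sum>x\<in>pverts G. exp (u x) * \<phi> x * \<mu> x) / exp_mass u)) (at 0)"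
proof -
  have "((\<lambda>t. exp_mass (\<lambda>x. u x + t * \<phi> x)) has_real_derivative
          (\<Sum>x\<in>pverts G. exp (u x) * \<phi> x * \<mu> x)) (at 0)"
    unfolding exp_mass_def by (auto intro!: derivative_eq_intros sum.cong)
  then have ln_deriv: "((\<lambda>t. ln (exp_mass (\<lambda>x. u x + t * \<phi> x))) has_real_derivative
          (\<Sum>x\<in>pverts G. exp (u x) * \<phi> x * \<mu> x) / exp_mass u) (at 0)"
    using exp_mass_pos[OF assms, of u] by (auto intro!: derivative_eq_intros)
  show ?thesis
    unfolding liouville_functional_def dirichlet_form_line
    by (rule derivative_eq_intros ln_deriv refl | simp)+
qed

text \<open>
  Testing the vanishing derivative against the indicator of \<open>z\<close> isolates the equation at \<open>z\<close>,
  multiplied by \<open>\<mu> z\<close>.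
\<close>

lemma euler_lagrange:
  assumes min: "\<And>v. liouville_functional x0 \<rho> u \<le> liouville_functional x0 \<rho> v"
    and z: "z \<in> pverts G"
  shows "graph_laplacian G w \<mu> u z + \<rho> / exp_mass u * exp (u z) = \<rho> * dirac_delta \<mu> x0 z"
proof -
  let ?\<phi> = "\<lambda>x. if x = z then 1 else 0 :: real"
  have ne: "pverts G \<noteq> {}" using z by blast
  have "dirichlet_form u ?\<phi> + \<rho> * ?\<phi> x0
      - \<rho> * ((\<Sum>x\<in>pverts G. exp (u x) * ?\<phi> x * \<mu> x) / exp_mass u) = 0"
    by (rule DERIV_local_min[OF has_real_derivative_liouville_functional[OF ne], of 1])
      (simp_all add: min)
  moreover have "(\<Sum>x\<in>pverts G. f x * ?\<phi> x * \<mu> x) = f z * \<mu> z" for f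
  proof -
    have "(\<Sum>x\<in>pverts G. f x * ?\<phi> x * \<mu> x) = (\<Sum>x\<in>pverts G. if x = z then f x * \<mu> x else 0)"
      by (intro sum.cong) auto
    then show ?thesis using z pair_finite_verts by simp
  qed
  ultimately have "- (graph_laplacian G w \<mu> u z * \<mu> z) + \<rho> * ?\<phi> x0
      - \<rho> * (exp (u z) * \<mu> z / exp_mass u) = 0"
    by (simp add: green_formula)
  then have "(graph_laplacian G w \<mu> u z + \<rho> / exp_mass u * exp (u z)) * \<mu> z = \<rho> * ?\<phi> x0"
    by (simp add: algebra_simps)
  with measure_pos[OF z] have
    "graph_laplacian G w \<mu> u z + \<rho> / exp_mass u * exp (u z) = \<rho> * ?\<phi> x0 / \<mu> z"
    by (simp add: eq_divide_eq)
  then show ?thesis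
    by (auto simp: dirac_delta_def)
qed

end

section \<open>Existence of solutions\<close>

theorem theorem2p1:
  fixes G :: "'a pair_pre_digraph"
    and w :: "'a \<Rightarrow> 'a \<Rightarrow> real"
    and \<mu> :: "'a \<Rightarrow> real"
    and x0 :: 'a
    and \<rho> :: real
  assumes "pair_graph G"
    and "Digraph_Component.connected (with_proj G)"
    and "\<And>x y. (x, y) \<in> parcs G \<Longrightarrow> w x y > 0"
    and "\<And>x y. (x, y) \<in> parcs G \<Longrightarrow> w x y = w y x"
    and "\<And>x. x \<in> pverts G \<Longrightarrow> \<mu> x > 0"
    and "x0 \<in> pverts G"
    and "\<rho> > 0"
  shows "\<exists>u :: 'a \<Rightarrow> real. \<forall>x\<in>pverts G.
           graph_laplacian G w \<mu> u x + exp (u x) = \<rho> * dirac_delta \<mu> x0 x"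
proof -
  interpret pair_graph G by fact
  interpret weighted_graph G w \<mu>
    using assms(3-5) by unfold_locales auto
  obtain u where u: "\<And>v. liouville_functional x0 \<rho> u \<le> liouville_functional x0 \<rho> v"
    using liouville_functional_attains_min assms(2,6,7) by blast
  define v where "v x = u x + ln (\<rho> / exp_mass u)" for x
  have "exp_mass u > 0" using exp_mass_pos assms(6) by blast
  then have "exp (v x) = \<rho> / exp_mass u * exp (u x)" for x
    using assms(7) by (simp add: v_def exp_add)
  moreover have "graph_laplacian G w \<mu> v x = graph_laplacian G w \<mu> u x" for x
    by (simp add: graph_laplacian_def v_def)
  ultimately show ?thesis
    using euler_lagrange[OF u] by (intro exI[of _ v]) simp
qed

end
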